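(* Let $A=(f_1,\dots,f_n)$ be a system of $n$ tropical polynomials in $n$ variables with finite coefficients and let $x\in\mathbb{R}^n$ be a solution of $A$. Then $x$ is a stable solution of $A$ if and only if one can choose $2n$ monomials $m_{i,j}$, $1\le i\le n$, $1\le j\le 2$, such that: (1) for each $i$, the monomials $m_{i,1}$ and $m_{i,2}$ are monomials of the $i$-th polynomial $f_i$ and they are starred (in row $i$) in $A^{*x}$; (2) the linear span of the vectors $v_n(m_{1,1},m_{1,2}),\,v_n(m_{2,1},m_{2,2}),\dots,v_n(m_{n,1},m_{n,2})$ has dimension $n$.
   Context: A tropical polynomial $f$ in $n$ variables is given by a nonempty finite set of tropical monomials $Q_j(x)=a_j+i_{j1}x_1+\cdots+i_{jn}x_n$ with coefficients $a_j\in\mathbb{R}$ and pairwise distinct exponent vectors $(i_{j1},\dots,i_{jn})\in\mathbb{Z}_{\ge 0}^n$; $f(x)=\min_j Q_j(x)$. The tropical degree of $Q_j$ is $i_{j1}+\cdots+i_{jn}$, and the tropical degree of $f$ is the maximum of the degrees of its monomials. A tropical polynomial of tropical degree $e$ has finite coefficients if every monomial of tropical degree at most $e$ occurs in it. A point $x\in\mathbb{R}^n$ is a tropical zero of $f$ if $\min_j Q_j(x)$ is attained for at least two different $j$; a solution of a system is a point of $\mathbb{R}^n$ that is a tropical zero of each of its polynomials. Star table: the entry $(i,m)$ of $A^{*x}$ (rows: polynomials of $A$; columns: monomials) carries a star if and only if the monomial with exponent vector $m$ occurs in $f_i$ and attains at $x$ the minimal value among all monomials of $f_i$. For tropical monomials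 $m_1,m_2$ with exponent vectors $p_n(m_1),p_n(m_2)$, put $v_n(m_1,m_2)=p_n(m_2)-p_n(m_1)\in\mathbb{R}^n$. Stability: a perturbation of $A$ is a system with the same monomials in each polynomial but possibly different (real) coefficients; its amplitude is the maximal absolute difference between corresponding coefficients. A point $x$ is a stable point (stable solution) of $A$ if every sufficiently small generic perturbation of $A$ has solutions near $x$: there is $\Delta>0$ such that for every $0<\delta<\Delta$ there is $\varepsilon>0$ such that every generic perturbation of amplitude at most $\varepsilon$ has at least one solution in the $\delta$-neighbourhood of $x$. Here "generic" means that the coefficient vector of the perturbed system lies outside some finite union of proper affine hyperplanes of the space of coefficient vectors. *)

theory Defs
  imports "HOL-Analysis.Analysis"
begin

text \<open>
  Monomials are identified with their exponent vectors. A tropical polynomial in CARD('n)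
  variables is the partial map sending each occurring monomial to its real coefficient; a square
  system has one polynomial for each index in 'n, the same type that indexes the variables.
\<close>

type_synonym 'n monomial = "(nat, 'n) vec"
type_synonym 'n trop_poly = "'n monomial \<rightharpoonup> real"
type_synonym 'n trop_system = "'n \<Rightarrow> 'n trop_poly"

definition is_trop_poly :: "'n::finite trop_poly \<Rightarrow> bool" where
  "is_trop_poly f \<longleftrightarrow> finite (dom f) \<and> dom f \<noteq> {}"

definition monomial_degree :: "'n::finite monomial \<Rightarrow> nat" where
  "monomial_degree m = (\<Sum>k\<in>UNIV. m $ k)"

definition trop_degree :: "'n::finite trop_poly \<Rightarrow> nat" where
  "trop_degree f = Max (monomial_degree ` dom f)"

definition finite_coefficients :: "'n::finite trop_poly \<Rightarrow> bool" where
  "finite_coefficients f \<longleftrightarrow> (\<forall>m. monomial_degree m \<le> trop_degree f \<longrightarrow> m \<in> dom f)"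

definition monomial_value :: "'n::finite trop_poly \<Rightarrow> 'n monomial \<Rightarrow> real ^ 'n \<Rightarrow> real" where
  "monomial_value f m x = the (f m) + (\<Sum>k\<in>UNIV. real (m $ k) * x $ k)"

definition trop_eval :: "'n::finite trop_poly \<Rightarrow> real ^ 'n \<Rightarrow> real" where
  "trop_eval f x = Min ((\<lambda>m. monomial_value f m x) ` dom f)"

definition trop_zero :: "'n::finite trop_poly \<Rightarrow> real ^ 'n \<Rightarrow> bool" where
  "trop_zero f x \<longleftrightarrow>
     (\<exists>m\<in>dom f. \<exists>m'\<in>dom f. m \<noteq> m' \<and>
        monomial_value f m x = trop_eval f x \<and> monomial_value f m' x = trop_eval f x)"

definition solution :: "'n::finite trop_system \<Rightarrow> real ^ 'n \<Rightarrow> bool" where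
  "solution A x \<longleftrightarrow> (\<forall>i. trop_zero (A i) x)"

definition starred :: "'n::finite trop_system \<Rightarrow> real ^ 'n \<Rightarrow> 'n \<Rightarrow> 'n monomial \<Rightarrow> bool" where
  "starred A x i m \<longleftrightarrow> m \<in> dom (A i) \<and> monomial_value (A i) m x = trop_eval (A i) x"

definition exponent_diff :: "'n::finite monomial \<Rightarrow> 'n monomial \<Rightarrow> real ^ 'n" where
  "exponent_diff m m' = (\<chi> k. real (m' $ k) - real (m $ k))"

definition coeff_index :: "'n::finite trop_system \<Rightarrow> ('n \<times> 'n monomial) set" where
  "coeff_index A = (SIGMA i:UNIV. dom (A i))"

definition coeff_vec :: "'n::finite trop_system \<Rightarrow> 'n \<times> 'n monomial \<Rightarrow> real" where
  "coeff_vec A = (\<lambda>(i, m). the (A i m))"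

definition perturbation :: "'n::finite trop_system \<Rightarrow> 'n trop_system \<Rightarrow> bool" where
  "perturbation A B \<longleftrightarrow> (\<forall>i. dom (B i) = dom (A i))"

definition amplitude :: "'n::finite trop_system \<Rightarrow> 'n trop_system \<Rightarrow> real" where
  "amplitude A B = Max ((\<lambda>p. \<bar>coeff_vec B p - coeff_vec A p\<bar>) ` coeff_index A)"

text \<open>
  The space of coefficient vectors is \<open>\<real>\<close> to the power \<open>I\<close>, for the finite set \<open>I\<close> of pairs
  (polynomial, monomial occurring in it). Vectors are total functions of which only the values
  on \<open>I\<close> matter.
\<close>

definition affine_hyperplane :: "'a set \<Rightarrow> ('a \<Rightarrow> real) set \<Rightarrow> bool" where
  "affine_hyperplane I H \<longleftrightarrow>
     (\<exists>\<alpha> \<beta>. (\<exists>p\<in>I. \<alpha> p \<noteq> 0) \<and> H = {c. (\<Sum>p\<in>I. \<alpha> p * c p) = \<beta>})"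

text \<open>
  The finite family \<open>\<H>\<close> of exceptional hyperplanes is chosen first, so that one notion of
  genericity serves all \<open>\<delta>\<close> and \<open>\<epsilon>\<close>.
\<close>

definition stable_point :: "'n::finite trop_system \<Rightarrow> real ^ 'n \<Rightarrow> bool" where
  "stable_point A x \<longleftrightarrow>
     (\<exists>\<H>. finite \<H> \<and> (\<forall>H\<in>\<H>. affine_hyperplane (coeff_index A) H) \<and>
       (\<exists>\<Delta>>0. \<forall>\<delta>. 0 < \<delta> \<and> \<delta> < \<Delta> \<longrightarrow>
         (\<exists>\<epsilon>>0. \<forall>B. perturbation A B \<and> coeff_vec B \<notin> \<Union>\<H> \<and> amplitude A B \<le> \<epsilon> \<longrightarrow>
           (\<exists>y\<in>ball x \<delta>. solution B y))))"

end

theory Submission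
  imports Defs
begin

text \<open>
  Near \<open>x\<close>, and for small perturbations, only the monomials starred at \<open>x\<close> can attain the
  minimum in their row (\<open>active_near\<close>). So stability is a question about the finite set \<open>I\<close> of
  starred monomials: does the system restricted to \<open>I\<close>, with coefficients \<open>c\<close> close to the given
  ones, have a solution close to \<open>x\<close>? Call \<open>y\<close> a crossing if every row attains its minimum at \<open>y\<close>
  on two monomials \<open>p i\<close>, \<open>q i\<close> whose difference vectors form a basis. For given \<open>p\<close> and \<open>q\<close>,
  a crossing is determined by \<open>n\<close> linear equations whose matrix does not depend on \<open>c\<close>, so a
  crossing for \<open>c\<close> lies at a distance from \<open>x\<close> that is at most proportional to the size of the
  perturbation (\<open>crossing_bound\<close>).

  Genericity is expressed by the Cayley trick: the monomial \<open>m\<close> of row \<open>i\<close> becomes the vector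
  \<open>(e\<^sub>i, m)\<close> of a space of dimension \<open>2n\<close>. A set of monomials is tied row by row at a point \<open>y\<close>
  exactly if its coefficients are the values of one linear functional on these vectors. A linear
  dependence between the vectors therefore puts \<open>c\<close> on a hyperplane, and outside finitely many
  hyperplanes all sets of tied monomials have independent vectors
  (\<open>generic_outside_hyperplanes\<close>).

  \<^emph>\<open>Stable implies transversal.\<close> Take a generic perturbation with a solution near \<open>x\<close>. The \<open>2n\<close>
  monomials tied at the solution have independent vectors, hence the differences of the two
  monomials in each row form a basis (\<open>transversal_if_cayley_independent\<close>).

  \<^emph>\<open>Transversal implies stable.\<close> Every generic \<open>c\<close> has a crossing on \<open>I\<close>
  (\<open>generic_crossing\<close>). This is clear when \<open>I\<close> consists of the two given monomials in each row.
  The others are added one at a time. A new monomial with a very large coefficient changes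
  nothing; then lower its coefficient \<open>s\<close> continuously to the required value. The set of those
  \<open>s\<close> for which there is a crossing is closed, because there are finitely many choices of
  \<open>p\<close> and \<open>q\<close>. It is also open: the coefficients other than \<open>s\<close> being generic, at most \<open>2n + 1\<close>
  monomials are minimal at a crossing, so all rows except one have just two of them. The ties
  in these \<open>n - 1\<close> rows survive on a line, along which the remaining row is the minimum of affine
  functions with at least two different slopes, and hence has a tie (\<open>crossing_persists\<close>). By
  connectedness there is a crossing for every \<open>s\<close>.
\<close>

section \<open>Active monomials, transversal vectors and crossings\<close>

definition expo :: "'n::finite monomial \<Rightarrow> real ^ 'n" where
  "expo m = (\<chi> k. real (m $ k))"

definition val :: "('n::finite \<times> 'n monomial \<Rightarrow> real) \<Rightarrow> 'n \<times> 'n monomial \<Rightarrow> real ^ 'n \<Rightarrow> real" where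
  "val c k y = c k + expo (snd k) \<bullet> y"

text \<open>
  If \<open>I\<close> contains all monomials of a system, these are the starred ones. A smaller \<open>I\<close> stands for
  the system in which the other monomials are deleted.
\<close>

definition active :: "('n::finite \<times> 'n monomial) set \<Rightarrow> ('n \<times> 'n monomial \<Rightarrow> real) \<Rightarrow> real ^ 'n
    \<Rightarrow> ('n \<times> 'n monomial) set" where
  "active I c y = {k \<in> I. \<forall>l\<in>I. fst l = fst k \<longrightarrow> val c k y \<le> val c l y}"

text \<open>
  Equivalently, the vectors form a basis (\<open>transversal_iff_dim\<close>). For difference vectors \<open>v i\<close> of
  tied monomials, \<open>u\<close> is a direction in which all ties persist.
\<close>

definition transversal :: "('n::finite \<Rightarrow> real ^ 'n) \<Rightarrow> bool" where
  "transversal v \<longleftrightarrow> (\<forall>u. (\<forall>i. v i \<bullet> u = 0) \<longrightarrow> u = 0)"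

definition crossing :: "('n::finite \<times> 'n monomial) set \<Rightarrow> ('n \<times> 'n monomial \<Rightarrow> real)
    \<Rightarrow> ('n \<Rightarrow> 'n monomial) \<Rightarrow> ('n \<Rightarrow> 'n monomial) \<Rightarrow> real ^ 'n \<Rightarrow> bool" where
  "crossing I c p q y \<longleftrightarrow>
     transversal (\<lambda>i. exponent_diff (p i) (q i)) \<and>
     (\<forall>i. (i, p i) \<in> active I c y \<and> (i, q i) \<in> active I c y)"

text \<open>
  The Cayley embedding of the monomials of all rows into one space, of dimension \<open>2n\<close>.
\<close>

definition cayley :: "'n::finite \<times> 'n monomial \<Rightarrow> (real ^ 'n) \<times> (real ^ 'n)" where
  "cayley k = (axis (fst k) 1, expo (snd k))"

text \<open>
  For \<open>z = (\<mu>, - y)\<close> the equations \<open>c k = cayley k \<bullet> z\<close> say that every monomial \<open>k\<close> of \<open>T\<close> in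
  row \<open>i\<close> has at \<open>y\<close> the value \<open>\<mu> $ i\<close>. So only independent sets of monomials can be tied
  simultaneously.
\<close>

definition generic :: "('n::finite \<times> 'n monomial) set \<Rightarrow> ('n \<times> 'n monomial \<Rightarrow> real) \<Rightarrow> bool" where
  "generic I c \<longleftrightarrow> (\<forall>T z. T \<subseteq> I \<and> (\<forall>k\<in>T. c k = cayley k \<bullet> z) \<longrightarrow> independent (cayley ` T))"

lemma exponent_diff_expo: "exponent_diff m m' = expo m' - expo m"
  by (simp add: exponent_diff_def expo_def vec_eq_iff)

lemma monomial_value_val: "monomial_value (A i) m x = val (coeff_vec A) (i, m) x"
  by (simp add: monomial_value_def val_def coeff_vec_def expo_def inner_vec_def)

lemma inj_cayley: "inj cayley"
proof (rule injI)
  fix k l :: "'a \<times> 'a monomial"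
  assume "cayley k = cayley l"
  then have "axis (fst k) (1::real) = axis (fst l) 1" "expo (snd k) = expo (snd l)"
    by (simp_all add: cayley_def)
  then have "fst k = fst l" "snd k = snd l"
    by (simp add: axis_eq_axis, simp add: expo_def vec_eq_iff)
  then show "k = l" by (rule prod_eqI)
qed

lemma transversal_iff_dim:
  fixes v :: "'n::finite \<Rightarrow> real ^ 'n"
  shows "transversal v \<longleftrightarrow> dim (span (range v)) = CARD('n)"
proof
  assume t: "transversal v"
  show "dim (span (range v)) = CARD('n)"
  proof (rule ccontr)
    assume "dim (span (range v)) \<noteq> CARD('n)"
    then have "span (range v) \<noteq> UNIV"
      by (metis dim_UNIV DIM_cart DIM_real mult.right_neutral)
    then obtain a where "a \<noteq> 0" "\<forall>x\<in>span (range v). a \<bullet> x = 0"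
      using span_not_UNIV_orthogonal by blast
    then show False
      using t by (metis transversal_def inner_commute rangeI span_base)
  qed
next
  assume "dim (span (range v)) = CARD('n)"
  then have U: "span (range v) = UNIV"
    by (metis DIM_cart DIM_real dim_eq_full mult.right_neutral span_span)
  show "transversal v"
    unfolding transversal_def
  proof (intro allI impI)
    fix u assume u: "\<forall>i. v i \<bullet> u = 0"
    have "orthogonal u w" if "w \<in> span (range v)" for w
      using u by (intro orthogonal_to_span[OF that]) (auto simp: orthogonal_def inner_commute)
    from this[of u] U show "u = 0"
      by (simp add: orthogonal_self)
  qed
qed

lemma transversal_solve:
  fixes v :: "'n::finite \<Rightarrow> real ^ 'n"
  assumes "transversal v"
  obtains N :: "real ^ 'n \<Rightarrow> real ^ 'n" where "linear N" "\<And>w i. v i \<bullet> N w = w $ i"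
proof -
  let ?L = "\<lambda>u. \<chi> i. v i \<bullet> u"
  have lin: "linear ?L"
    by (rule linearI) (auto simp: vec_eq_iff inner_add_right)
  have "inj ?L"
    using assms by (subst linear_injective_0[OF lin]) (auto simp: transversal_def vec_eq_iff)
  then obtain N where N: "linear N" "\<And>x. ?L (N x) = x"
    using linear_injective_isomorphism[OF lin] by blast
  have "v i \<bullet> N w = w $ i" for w i
    using N(2)[of w] by (metis vec_lambda_beta)
  with N(1) show ?thesis by (rule that)
qed

section \<open>Generic coefficient vectors\<close>

text \<open>
  Each dependent subset of \<open>I\<close> contributes one hyperplane: applying \<open>z\<close> to a relation
  \<open>\<Sum> \<alpha> k *\<^sub>R cayley k = 0\<close> gives the equation \<open>\<Sum> \<alpha> k * c k = 0\<close>.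
\<close>

lemma generic_outside_hyperplanes:
  fixes I J :: "('n::finite \<times> 'n monomial) set"
  assumes "finite J" "I \<subseteq> J"
  obtains \<H> where "finite \<H>" "\<And>H. H \<in> \<H> \<Longrightarrow> affine_hyperplane J H"
    "\<And>c. c \<notin> \<Union>\<H> \<Longrightarrow> generic I c"
proof -
  let ?D = "{T. T \<subseteq> I \<and> dependent (cayley ` T)}"
  have "\<forall>T\<in>?D. \<exists>\<alpha>. (\<exists>k\<in>T. \<alpha> k \<noteq> 0) \<and> (\<Sum>k\<in>T. \<alpha> k *\<^sub>R cayley k) = 0"
  proof
    fix T assume T: "T \<in> ?D"
    then have fin: "finite T"
      using assms by (auto intro: finite_subset)
    then obtain u where u: "\<exists>w\<in>cayley ` T. u w \<noteq> 0" "(\<Sum>w\<in>cayley ` T. u w *\<^sub>R w) = 0"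
      using T dependent_finite[of "cayley ` T"] by auto
    have "(\<Sum>k\<in>T. u (cayley k) *\<^sub>R cayley k) = 0"
      using u(2) by (subst (asm) sum.reindex) (auto intro: inj_on_subset[OF inj_cayley])
    then show "\<exists>\<alpha>. (\<exists>k\<in>T. \<alpha> k \<noteq> 0) \<and> (\<Sum>k\<in>T. \<alpha> k *\<^sub>R cayley k) = 0"
      using u(1) by (intro exI[of _ "u \<circ> cayley"]) auto
  qed
  from bchoice[OF this] obtain \<alpha> where
    \<alpha>': "\<forall>T\<in>?D. (\<exists>k\<in>T. \<alpha> T k \<noteq> (0::real)) \<and> (\<Sum>k\<in>T. \<alpha> T k *\<^sub>R cayley k) = 0"
    by blast
  have \<alpha>: "\<exists>k\<in>T. \<alpha> T k \<noteq> 0" "(\<Sum>k\<in>T. \<alpha> T k *\<^sub>R cayley k) = 0" if "T \<in> ?D" for T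
    using bspec[OF \<alpha>' that] by (rule conjunct1, rule conjunct2)
  define H where "H T = {c. (\<Sum>k\<in>J. (if k \<in> T then \<alpha> T k else 0) * c k) = (0::real)}" for T
  show ?thesis
  proof (rule that[of "H ` ?D"])
    have "finite I" using assms finite_subset by auto
    then show "finite (H ` ?D)" by simp
  next
    fix G assume "G \<in> H ` ?D"
    then obtain T where T: "T \<in> ?D" "G = H T" by auto
    obtain k where "k \<in> T" "\<alpha> T k \<noteq> 0" using \<alpha>(1)[OF T(1)] by auto
    then show "affine_hyperplane J G"
      unfolding affine_hyperplane_def T(2) H_def using T(1) assms(2)
      by (intro exI[of _ "\<lambda>k. if k \<in> T then \<alpha> T k else 0"] exI[of _ 0] conjI bexI[of _ k]) auto
  next
    fix c assume c: "c \<notin> \<Union>(H ` ?D)"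
    show "generic I c"
      unfolding generic_def
    proof (intro allI impI)
      fix T z assume T: "T \<subseteq> I \<and> (\<forall>k\<in>T. c k = cayley k \<bullet> z)"
      show "independent (cayley ` T)"
      proof (rule ccontr)
        assume "\<not> independent (cayley ` T)"
        then have TD: "T \<in> ?D" using T by auto
        have "(\<Sum>k\<in>J. (if k \<in> T then \<alpha> T k else 0) * c k) = (\<Sum>k\<in>T. \<alpha> T k * c k)"
          using assms T by (intro sum.mono_neutral_cong_right) auto
        also have "\<dots> = (\<Sum>k\<in>T. \<alpha> T k *\<^sub>R cayley k) \<bullet> z"
          using T by (simp add: inner_sum_left)
        also have "\<dots> = 0" using \<alpha>(2)[OF TD] by simp
        finally have "c \<in> H T" by (simp add: H_def)
        with c TD show False by blast
      qed
    qed
  qed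
qed

lemma generic_subset:
  assumes "generic I c" "J \<subseteq> I"
  shows "generic J c"
  unfolding generic_def
proof (intro allI impI)
  fix T z assume "T \<subseteq> J \<and> (\<forall>k\<in>T. c k = cayley k \<bullet> z)"
  then have "T \<subseteq> I \<and> (\<forall>k\<in>T. c k = cayley k \<bullet> z)" using assms(2) by auto
  then show "independent (cayley ` T)" using assms(1) unfolding generic_def by blast
qed

lemma generic_tied:
  fixes T :: "('n::finite \<times> 'n monomial) set"
  assumes "generic I c" "T \<subseteq> I" "\<And>k. k \<in> T \<Longrightarrow> val c k y = \<mu> (fst k)"
  shows "independent (cayley ` T)"
proof -
  have "c k = cayley k \<bullet> ((\<chi> i. \<mu> i), - y)" if "k \<in> T" for k
    using assms(3)[OF that] by (simp add: cayley_def val_def inner_axis' inner_real_def)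
  then show ?thesis using assms(1,2) unfolding generic_def by blast
qed

lemma card_cayley: "card (cayley ` T) = card T"
  by (rule card_image) (rule inj_on_subset[OF inj_cayley subset_UNIV])

text \<open>
  A point outside the previous hyperplanes is moved along a coordinate axis that is transverse to
  the new one. Such a line meets each of the hyperplanes in at most one point.
\<close>

lemma avoid_hyperplanes:
  fixes a :: "'a \<Rightarrow> real"
  assumes "finite J" "finite \<H>" "\<And>H. H \<in> \<H> \<Longrightarrow> affine_hyperplane J H" "\<epsilon> > 0"
  shows "\<exists>c. c \<notin> \<Union>\<H> \<and> (\<forall>k\<in>J. \<bar>c k - a k\<bar> \<le> \<epsilon>)"
  using assms(2-4)
proof (induction \<H> arbitrary: \<epsilon> rule: finite_induct)
  case empty
  then show ?case by (intro exI[of _ a]) auto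
next
  case (insert H0 \<H>)
  obtain c where c: "c \<notin> \<Union>\<H>" "\<And>k. k \<in> J \<Longrightarrow> \<bar>c k - a k\<bar> \<le> \<epsilon> / 2"
    using insert.IH[of "\<epsilon> / 2"] insert.prems by auto
  obtain \<alpha>0 \<beta>0 k0 where H0: "k0 \<in> J" "\<alpha>0 k0 \<noteq> 0" "H0 = {c. (\<Sum>k\<in>J. \<alpha>0 k * c k) = \<beta>0}"
    using insert.prems(1)[of H0] by (auto simp: affine_hyperplane_def)
  have shift: "(\<Sum>k\<in>J. \<alpha> k * (c(k0 := c k0 + t)) k) = (\<Sum>k\<in>J. \<alpha> k * c k) + \<alpha> k0 * t" for \<alpha> t
  proof -
    have "(\<Sum>k\<in>J. \<alpha> k * (c(k0 := c k0 + t)) k) = (\<Sum>k\<in>J. \<alpha> k * c k + (if k = k0 then \<alpha> k0 * t else 0))"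
      by (intro sum.cong) (auto simp: algebra_simps)
    then show ?thesis using assms(1) H0(1) by (simp add: sum.distrib)
  qed
  have one: "finite {t. c(k0 := c k0 + t) \<in> H}" if Hin: "H \<in> insert H0 \<H>" for H
  proof -
    obtain \<alpha> \<beta> where H: "H = {c. (\<Sum>k\<in>J. \<alpha> k * c k) = \<beta>}"
      using insert.prems(1)[OF Hin] by (auto simp: affine_hyperplane_def)
    show ?thesis
    proof (cases "\<alpha> k0 = 0")
      case True
      \<comment> \<open>The line is parallel to \<open>H\<close>. As \<open>c\<close> avoids \<open>\<H>\<close>, it misses \<open>H\<close> if \<open>H \<in> \<H>\<close>.\<close>
      show ?thesis
      proof (cases "H \<in> \<H>")
        case True
        with c(1) \<open>\<alpha> k0 = 0\<close> have "{t. c(k0 := c k0 + t) \<in> H} = {}"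
          unfolding H mem_Collect_eq shift by auto
        then show ?thesis by simp
      next
        case False
        then have "H = H0" using Hin by simp
        have "{t. c(k0 := c k0 + t) \<in> H} \<subseteq> {(\<beta>0 - (\<Sum>k\<in>J. \<alpha>0 k * c k)) / \<alpha>0 k0}"
          unfolding \<open>H = H0\<close> H0(3) mem_Collect_eq shift using H0(2) by (auto simp: field_simps)
        then show ?thesis using finite_subset by blast
      qed
    next
      case False
      then have "{t. c(k0 := c k0 + t) \<in> H} \<subseteq> {(\<beta> - (\<Sum>k\<in>J. \<alpha> k * c k)) / \<alpha> k0}"
        unfolding H mem_Collect_eq shift by (auto simp: field_simps)
      then show ?thesis using finite_subset by blast
    qed
  qed
  have "finite (\<Union>H\<in>insert H0 \<H>. {t. c(k0 := c k0 + t) \<in> H})"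
    using insert.hyps(1) one by blast
  moreover have "infinite {0<..<\<epsilon> / 2}" using insert.prems by simp
  ultimately obtain t where t: "t \<in> {0<..<\<epsilon> / 2}" "t \<notin> (\<Union>H\<in>insert H0 \<H>. {t. c(k0 := c k0 + t) \<in> H})"
    by (meson finite_subset subsetI)
  show ?case
  proof (intro exI[of _ "c(k0 := c k0 + t)"] conjI ballI)
    show "c(k0 := c k0 + t) \<notin> \<Union> (insert H0 \<H>)" using t(2) by blast
    fix k assume "k \<in> J"
    have "\<bar>(c(k0 := c k0 + t)) k - c k\<bar> \<le> \<epsilon> / 2" using t(1) by auto
    then show "\<bar>(c(k0 := c k0 + t)) k - a k\<bar> \<le> \<epsilon>"
      using c(2)[OF \<open>k \<in> J\<close>] by linarith
  qed
qed

section \<open>Crossings persist when only one row has extra active monomials\<close>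

lemma continuous_on_Min_finite:
  fixes f :: "'a \<Rightarrow> real \<Rightarrow> real"
  assumes "finite U" "U \<noteq> {}" "\<And>k. k \<in> U \<Longrightarrow> continuous_on X (f k)"
  shows "continuous_on X (\<lambda>t. Min ((\<lambda>k. f k t) ` U))"
  using assms
proof (induction U rule: finite_ne_induct)
  case (insert k U)
  then have "(\<lambda>t. Min ((\<lambda>k. f k t) ` insert k U)) = (\<lambda>t. min (f k t) (Min ((\<lambda>k. f k t) ` U)))"
    by (intro ext) simp
  then show ?case using insert by (auto intro!: continuous_on_min)
qed simp

lemma finite_uniform_bound:
  fixes f :: "'a \<Rightarrow> real"
  assumes "finite I"
  obtains E where "E \<ge> 0" "\<And>k. k \<in> I \<Longrightarrow> \<bar>f k\<bar> \<le> E"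
proof (rule that)
  show "0 \<le> (\<Sum>k\<in>I. \<bar>f k\<bar>)" by (simp add: sum_nonneg)
  show "\<bar>f k\<bar> \<le> (\<Sum>k\<in>I. \<bar>f k\<bar>)" if "k \<in> I" for k
    using member_le_sum[of k I "\<lambda>k. \<bar>f k\<bar>"] that assms by simp
qed

lemma finite_uniform_gap:
  fixes f :: "'a \<Rightarrow> real"
  assumes "finite I" "\<And>k. k \<in> I \<Longrightarrow> f k > 0"
  obtains g where "g > 0" "g \<le> 1" "\<And>k. k \<in> I \<Longrightarrow> g \<le> f k"
proof (rule that)
  let ?g = "Min (insert 1 (f ` I))"
  show "?g > 0" "?g \<le> 1" using assms by auto
  show "?g \<le> f k" if "k \<in> I" for k using assms that by auto
qed

text \<open>
  The new coefficients \<open>c'\<close> determine a line, with direction \<open>u\<close>, on which the ties between \<open>p i\<close>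
  and \<open>q i\<close> persist for all \<open>i \<noteq> j\<close>. Along this line the active monomials of row \<open>j\<close> become
  affine functions, among which \<open>p j\<close> and \<open>q j\<close> have slopes that differ by 1. They are split
  into those whose slope is at least that of \<open>q j\<close> and the others. The minimum over the former is the
  smaller one far to the left and the larger one far to the right, so by the intermediate value
  theorem the two minima agree somewhere. This gives a tie of minimal monomials with different slopes, that is, again a
  crossing.
\<close>

lemma crossing_persists:
  fixes I :: "('n::finite \<times> 'n monomial) set"
  assumes fin: "finite I" and cr: "crossing I c p q y"
    and pairs: "\<And>i k. i \<noteq> j \<Longrightarrow> k \<in> active I c y \<Longrightarrow> fst k = i \<Longrightarrow> k = (i, p i) \<or> k = (i, q i)"
  obtains \<eta> where "\<eta> > 0"
    "\<And>c'. (\<And>k. k \<in> I \<Longrightarrow> \<bar>c' k - c k\<bar> \<le> \<eta>) \<Longrightarrow> \<exists>p' q' y'. crossing I c' p' q' y'"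
proof -
  define v where "v i = exponent_diff (p i) (q i)" for i
  have tv: "transversal v" using cr by (simp add: crossing_def v_def[abs_def])
  obtain N where N: "linear N" "\<And>w i. v i \<bullet> N w = w $ i"
    using transversal_solve[OF tv] by blast
  obtain K where K: "K > 0" "\<And>w. norm (N w) \<le> K * norm w"
    using linear_bounded_pos[OF N(1)] by blast
  define u where "u = N (axis j 1)"
  have vu: "v i \<bullet> u = (if i = j then 1 else 0)" for i
    by (simp add: u_def N(2) axis_def)
  define e where "e k = expo (snd k)" for k :: "'n \<times> 'n monomial"
  define \<sigma> where "\<sigma> k = e k \<bullet> u" for k
  define M where "M i = val c (i, p i) y" for i
  have actp: "(i, p i) \<in> active I c y" and actq: "(i, q i) \<in> active I c y" for i
    using cr by (auto simp: crossing_def)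
  have M: "val c k y = M (fst k)" if "k \<in> active I c y" for k
    using that actp[of "fst k"] unfolding M_def active_def by (auto intro!: antisym)
  have pI: "(i, p i) \<in> I" and qI: "(i, q i) \<in> I" for i
    using actp actq by (auto simp: active_def)
  define R where "R = {k \<in> active I c y. fst k = j}"
  define U where "U = {k \<in> R. \<sigma> k \<ge> \<sigma> (j, q j)}"
  define V where "V = {k \<in> R. \<sigma> k < \<sigma> (j, q j)}"
  have finR: "finite R" using fin by (auto simp: R_def active_def)
  then have finU: "finite U" and finV: "finite V" by (auto simp: U_def V_def)
  have \<sigma>d: "\<sigma> (i, q i) - \<sigma> (i, p i) = (if i = j then 1 else 0)" for i
    using vu[of i] by (simp add: \<sigma>_def e_def v_def exponent_diff_expo inner_diff_left)
  have qU: "(j, q j) \<in> U" using actq by (auto simp: U_def R_def)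
  have pV: "(j, p j) \<in> V" using actp \<sigma>d[of j] by (auto simp: V_def R_def)
  obtain E where E: "E \<ge> 0" "\<And>k. k \<in> I \<Longrightarrow> norm (e k) \<le> E"
    using finite_uniform_bound[OF fin, of "\<lambda>k. norm (e k)"] by auto
  obtain S where S: "S \<ge> 0" "\<And>k. k \<in> I \<Longrightarrow> \<bar>\<sigma> k\<bar> \<le> S"
    using finite_uniform_bound[OF fin, of \<sigma>] by auto
  have "val c k y - M (fst k) > 0" if k: "k \<in> I - active I c y" for k
  proof -
    obtain l where l: "l \<in> I" "fst l = fst k" "val c l y < val c k y"
      using k unfolding active_def by fastforce
    then show ?thesis using actp[of "fst k"] unfolding M_def active_def by auto
  qed
  then obtain g where g: "g > 0" "g \<le> 1" "\<And>k. k \<in> I - active I c y \<Longrightarrow> g \<le> val c k y - M (fst k)"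
    using finite_uniform_gap[of "I - active I c y" "\<lambda>k. val c k y - M (fst k)"] fin by auto
  obtain \<gamma> where \<gamma>: "\<gamma> > 0" "\<gamma> \<le> 1" "\<And>k. k \<in> V \<Longrightarrow> \<gamma> \<le> \<sigma> (j, q j) - \<sigma> k"
    using finite_uniform_gap[OF finV, of "\<lambda>k. \<sigma> (j, q j) - \<sigma> k"] by (auto simp: V_def)
  \<comment> \<open>\<open>g\<close> separates inactive monomials from the minimum and \<open>\<gamma>\<close> separates the slopes in \<open>V\<close> from that
    of \<open>q j\<close>. A perturbation of size \<open>\<eta>\<close> changes values at the base point of the line by at most \<open>C * \<eta>\<close>.
    The line is followed for times up to \<open>\<kappa>\<close>: so short that \<open>g\<close> is not used up, but, since \<open>\<eta>\<close> is chosen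
    after \<open>\<kappa>\<close>, long enough for the slopes to outweigh the perturbation.\<close>
  define C where "C = 1 + E * (K * (CARD('n) * 2))"
  have C: "C \<ge> 1" using E K by (simp add: C_def)
  define \<kappa> where "\<kappa> = g / (4 * (S + 1))"
  have \<kappa>: "\<kappa> > 0" "\<kappa> \<le> g / 4" "4 * (S * \<kappa>) < g"
    using g S by (auto simp: \<kappa>_def field_simps)
  define \<eta> where "\<eta> = \<gamma> * \<kappa> / (2 * C)"
  have \<eta>: "\<eta> > 0" "2 * (C * \<eta>) = \<gamma> * \<kappa>"
    using \<gamma> \<kappa> C by (auto simp: \<eta>_def)
  have \<gamma>\<kappa>: "\<gamma> * \<kappa> \<le> \<kappa>" using \<gamma> \<kappa> by (simp add: mult_left_le_one_le)
  show ?thesis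
  proof (rule that[OF \<eta>(1)])
    fix c' assume c': "\<And>k. k \<in> I \<Longrightarrow> \<bar>c' k - c k\<bar> \<le> \<eta>"
    define \<delta> where "\<delta> k = c' k - c k" for k
    define w where "w = (\<chi> i. if i = j then 0 else \<delta> (i, p i) - \<delta> (i, q i))"
    have "\<bar>w $ i\<bar> \<le> 2 * \<eta>" for i
      using c'[OF pI[of i]] c'[OF qI[of i]] \<eta>(1) by (auto simp: w_def \<delta>_def)
    then have "norm w \<le> CARD('n) * (2 * \<eta>)"
      using norm_le_l1_cart[of w] sum_bounded_above[of UNIV "\<lambda>i. \<bar>w $ i\<bar>" "2 * \<eta>"] by force
    then have Nw: "norm (N w) \<le> K * (CARD('n) * (2 * \<eta>))"
      using K by (meson mult_left_mono order_trans less_imp_le)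
    define Y where "Y t = y + N w + t *\<^sub>R u" for t
    define \<rho> where "\<rho> k = \<delta> k + e k \<bullet> N w" for k
    have \<rho>: "\<bar>\<rho> k\<bar> \<le> C * \<eta>" if "k \<in> I" for k
    proof -
      have "\<bar>e k \<bullet> N w\<bar> \<le> norm (e k) * norm (N w)" by (rule Cauchy_Schwarz_ineq2)
      also have "\<dots> \<le> E * (K * (CARD('n) * (2 * \<eta>)))"
        using E(2)[OF that] Nw E(1) by (intro mult_mono) auto
      finally show ?thesis using c'[OF that] unfolding \<rho>_def \<delta>_def C_def
        by (simp add: algebra_simps abs_le_iff)
    qed
    have valY: "val c' k (Y t) = val c k y + \<rho> k + t * \<sigma> k" for k t
      by (simp add: val_def Y_def \<rho>_def \<delta>_def \<sigma>_def e_def inner_add_right)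
    define f where "f k t = \<rho> k + t * \<sigma> k" for k t
    define h where "h t = Min ((\<lambda>k. f k t) ` U) - Min ((\<lambda>k. f k t) ` V)" for t
    have ne: "U \<noteq> {}" "V \<noteq> {}" using qU pV by auto
    have UI: "U \<subseteq> I" and VI: "V \<subseteq> I" by (auto simp: U_def V_def R_def active_def)
    have "continuous_on {-\<kappa>..\<kappa>} h"
      unfolding h_def f_def
      by (intro continuous_intros continuous_on_Min_finite finU finV ne)
    moreover have "h (-\<kappa>) \<le> 0"
    proof -
      have "Min ((\<lambda>k. f k (-\<kappa>)) ` U) \<le> f (j, q j) (-\<kappa>)" using finU qU by auto
      also have "\<dots> \<le> C * \<eta> - \<kappa> * \<sigma> (j, q j)" using \<rho>[OF qI[of j]] by (auto simp: f_def)
      also have "\<dots> \<le> Min ((\<lambda>k. f k (-\<kappa>)) ` V)"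
      proof (subst Min_ge_iff)
        show "\<forall>a\<in>(\<lambda>k. f k (- \<kappa>)) ` V. C * \<eta> - \<kappa> * \<sigma> (j, q j) \<le> a"
        proof clarify
          fix a b assume k: "(a, b) \<in> V"
          have "\<kappa> * \<gamma> \<le> \<kappa> * (\<sigma> (j, q j) - \<sigma> (a, b))" using \<gamma>(3)[OF k] \<kappa>(1) by simp
          then show "C * \<eta> - \<kappa> * \<sigma> (j, q j) \<le> f (a, b) (- \<kappa>)"
            using \<rho>[of "(a, b)"] k VI \<eta>(2) by (auto simp: f_def algebra_simps abs_le_iff)
        qed
      qed (use finV ne in auto)
      finally show ?thesis by (simp add: h_def)
    qed
    moreover have "h \<kappa> \<ge> 0"
    proof -
      have "Min ((\<lambda>k. f k \<kappa>) ` V) \<le> f (j, p j) \<kappa>" using finV pV by auto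
      also have "\<dots> \<le> C * \<eta> + \<kappa> * \<sigma> (j, p j)" using \<rho>[OF pI[of j]] by (auto simp: f_def)
      also have "\<dots> \<le> Min ((\<lambda>k. f k \<kappa>) ` U)"
      proof (subst Min_ge_iff)
        show "\<forall>a\<in>(\<lambda>k. f k \<kappa>) ` U. C * \<eta> + \<kappa> * \<sigma> (j, p j) \<le> a"
        proof clarify
          fix a b assume k: "(a, b) \<in> U"
          then have "\<sigma> (a, b) \<ge> \<sigma> (j, p j) + 1" using \<sigma>d[of j] by (simp add: U_def)
          then have "\<kappa> * (\<sigma> (j, p j) + 1) \<le> \<kappa> * \<sigma> (a, b)" using \<kappa>(1) by simp
          then show "C * \<eta> + \<kappa> * \<sigma> (j, p j) \<le> f (a, b) \<kappa>"
            using \<rho>[of "(a, b)"] k UI \<eta>(2) \<gamma>\<kappa> by (auto simp: f_def algebra_simps abs_le_iff)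
        qed
      qed (use finU ne in auto)
      finally show ?thesis by (simp add: h_def)
    qed
    ultimately obtain t where t: "-\<kappa> \<le> t" "t \<le> \<kappa>" "h t = 0"
      using IVT'[of h "-\<kappa>" 0 \<kappa>] \<kappa>(1) by auto
    have "Min ((\<lambda>k. f k t) ` U) \<in> (\<lambda>k. f k t) ` U" "Min ((\<lambda>k. f k t) ` V) \<in> (\<lambda>k. f k t) ` V"
      using finU finV ne by (auto intro!: Min_in)
    then obtain a b where a: "a \<in> V" "f a t = Min ((\<lambda>k. f k t) ` V)"
      and b: "b \<in> U" "f b t = Min ((\<lambda>k. f k t) ` U)"
      by force
    have ab: "f a t = f b t" using a b t(3) by (simp add: h_def)
    have minR: "f a t \<le> f k t" "f b t \<le> f k t" if "k \<in> R" for k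
    proof -
      have "k \<in> U \<or> k \<in> V" using that by (auto simp: U_def V_def)
      then have "f a t \<le> f k t"
      proof
        assume "k \<in> U"
        then have "f b t \<le> f k t" using b(2) finU by simp
        then show ?thesis using ab by simp
      next
        assume "k \<in> V"
        then show ?thesis using a(2) finV by simp
      qed
      then show "f a t \<le> f k t" "f b t \<le> f k t" using ab by auto
    qed
    \<comment> \<open>Inactive monomials stay above the active ones on this part of the line.\<close>
    have near: "\<bar>f k t\<bar> \<le> C * \<eta> + S * \<kappa>" if "k \<in> I" for k
    proof -
      have "\<bar>\<sigma> k * t\<bar> \<le> S * \<kappa>"
        unfolding abs_mult using t S(1) S(2)[OF that] by (intro mult_mono) auto
      then have "\<bar>t * \<sigma> k\<bar> \<le> S * \<kappa>" by (simp add: mult.commute)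
      then show ?thesis using \<rho>[OF that] by (auto simp: f_def abs_le_iff)
    qed
    have far: "val c' l (Y t) \<le> val c' k (Y t)"
      if "k \<in> I - active I c y" "l \<in> active I c y" "fst l = fst k" for k l
    proof -
      have "k \<in> I" "l \<in> I" using that by (auto simp: active_def)
      then have "f l t - f k t \<le> 2 * (C * \<eta>) + 2 * (S * \<kappa>)"
        using near[of k] near[of l] by linarith
      also have "\<dots> \<le> g" using \<eta>(2) \<gamma>\<kappa> \<kappa>(2,3) g(1) by linarith
      also have "\<dots> \<le> val c k y - val c l y" using g(3)[OF that(1)] M[OF that(2)] that(3) by simp
      finally show ?thesis by (simp add: valY f_def)
    qed
    define p' where "p' = p(j := snd a)"
    define q' where "q' = q(j := snd b)"
    have "a \<in> R" "b \<in> R" using a(1) b(1) by (auto simp: U_def V_def)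
    then have "fst a = j" "fst b = j" and ab_act: "a \<in> active I c y" "b \<in> active I c y"
      by (auto simp: R_def)
    then have aj: "(j, snd a) = a" "(j, snd b) = b" by (auto intro: prod_eqI)
    have "crossing I c' p' q' (Y t)"
      unfolding crossing_def
    proof (intro conjI allI)
      show "transversal (\<lambda>i. exponent_diff (p' i) (q' i))"
        unfolding transversal_def
      proof (intro allI impI)
        fix z assume z: "\<forall>i. exponent_diff (p' i) (q' i) \<bullet> z = 0"
        have "v i \<bullet> (z - (v j \<bullet> z) *\<^sub>R u) = 0" for i
          using vu[of i] spec[OF z, of i]
          by (cases "i = j") (auto simp: inner_diff_right v_def p'_def q'_def)
        \<comment> \<open>A vector orthogonal to the other differences is a multiple of \<open>u\<close>, along which \<open>a\<close> and
          \<open>b\<close> have different slopes.\<close>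
        then have zu: "z = (v j \<bullet> z) *\<^sub>R u"
          using tv unfolding transversal_def by (metis eq_iff_diff_eq_0)
        have "0 = (e b - e a) \<bullet> z"
          using spec[OF z, of j] by (simp add: p'_def q'_def exponent_diff_expo e_def)
        also have "\<dots> = (v j \<bullet> z) * (\<sigma> b - \<sigma> a)"
          by (subst zu) (simp add: \<sigma>_def inner_diff_left)
        finally have "v j \<bullet> z = 0" using a(1) b(1) by (auto simp: U_def V_def)
        then show "z = 0" using zu by simp
      qed
    next
      fix i
      have eq: "val c' (i, p' i) (Y t) = val c' (i, q' i) (Y t)"
      proof (cases "i = j")
        case True
        then show ?thesis using aj ab M[OF ab_act(1)] M[OF ab_act(2)] \<open>fst a = j\<close> \<open>fst b = j\<close>
          by (simp add: p'_def q'_def valY f_def)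
      next
        case False
        have "v i \<bullet> N w = \<delta> (i, p i) - \<delta> (i, q i)" using N(2)[of i w] False by (simp add: w_def)
        then have "\<rho> (i, p i) = \<rho> (i, q i)"
          by (simp add: \<rho>_def v_def exponent_diff_expo e_def inner_diff_left)
        then show ?thesis using False \<sigma>d[of i] M[OF actp[of i]] M[OF actq[of i]]
          by (simp add: p'_def q'_def valY)
      qed
      have act: "(i, p' i) \<in> active I c y" "(i, q' i) \<in> active I c y"
        using aj ab_act actp actq by (auto simp: p'_def q'_def)
      have le: "val c' (i, p' i) (Y t) \<le> val c' k (Y t)" if k: "k \<in> I" "fst k = i" for k
      proof (cases "k \<in> active I c y")
        case False
        then show ?thesis using far[of k "(i, p' i)"] act k by auto
      next
        case True
        show ?thesis
        proof (cases "i = j")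
          case True
          then have "k \<in> R" using k \<open>k \<in> active I c y\<close> by (simp add: R_def)
          then show ?thesis
            using minR(1)[of k] M[OF act(1)] M[OF \<open>k \<in> active I c y\<close>] aj k \<open>i = j\<close> \<open>fst a = j\<close>
            by (simp add: valY f_def p'_def)
        next
          case False
          then show ?thesis
            using pairs[OF False True k(2)] eq by (auto simp: p'_def q'_def)
        qed
      qed
      show "(i, p' i) \<in> active I c' (Y t)" "(i, q' i) \<in> active I c' (Y t)"
        using act le eq by (auto simp: active_def)
    qed
    then show "\<exists>p' q' y'. crossing I c' p' q' y'" by blast
  qed
qed

section \<open>Existence of crossings for generic coefficients\<close>

text \<open>
  For fixed \<open>p\<close> and \<open>q\<close> with transversal differences, the crossing is the solution of a linear
  system and so depends continuously on \<open>s\<close>; that it is one is then a closed condition.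
  There are finitely many \<open>p\<close> and \<open>q\<close>.
\<close>

lemma closed_crossing:
  fixes I :: "('n::finite \<times> 'n monomial) set"
  assumes fin: "finite I"
  shows "closed {s. \<exists>p q y. crossing I (c(k0 := s)) p q y}"
proof -
  \<comment> \<open>The choices are counted as functions into the finite set \<open>I\<close>.\<close>
  define G :: "('n \<Rightarrow> 'n \<times> 'n monomial) set" where "G = UNIV \<rightarrow>\<^sub>E I"
  have finG: "finite G" unfolding G_def by (rule finite_PiE) (use fin in auto)
  define X where "X p q = {s. \<exists>y. crossing I (c(k0 := s)) p q y}" for p q
  have "closed (X p q)" for p q
  proof (cases "transversal (\<lambda>i. exponent_diff (p i) (q i))")
    case False
    then have "X p q = {}" by (auto simp: X_def crossing_def)
    then show ?thesis by simp
  next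
    case True
    then obtain N where N: "linear N" "\<And>w i. exponent_diff (p i) (q i) \<bullet> N w = w $ i"
      using transversal_solve by blast
    define W where "W s = (\<chi> i. (c(k0 := s)) (i, p i) - (c(k0 := s)) (i, q i))" for s
    have uniq: "y = N (W s)" if "crossing I (c(k0 := s)) p q y" for s y
    proof -
      have "exponent_diff (p i) (q i) \<bullet> (y - N (W s)) = 0" for i
      proof -
        have "val (c(k0 := s)) (i, p i) y = val (c(k0 := s)) (i, q i) y"
          using that unfolding crossing_def active_def by (auto intro!: antisym)
        then have "exponent_diff (p i) (q i) \<bullet> y = W s $ i"
          by (simp add: W_def val_def exponent_diff_expo inner_diff_left)
        then show ?thesis by (simp add: inner_diff_right N(2))
      qed
      then show ?thesis using True unfolding transversal_def by (metis eq_iff_diff_eq_0)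
    qed
    have "X p q = {s. crossing I (c(k0 := s)) p q (N (W s))}"
      unfolding X_def using uniq by blast
    also have "\<dots> = {s. \<forall>i. (i, p i) \<in> I \<and> (i, q i) \<in> I \<and> (\<forall>l\<in>I. fst l = i \<longrightarrow>
        val (c(k0 := s)) (i, p i) (N (W s)) \<le> val (c(k0 := s)) l (N (W s)) \<and>
        val (c(k0 := s)) (i, q i) (N (W s)) \<le> val (c(k0 := s)) l (N (W s)))}"
      unfolding crossing_def active_def using True by auto
    also have "closed \<dots>"
    proof -
      have c: "continuous_on UNIV (\<lambda>s. (c(k0 := s)) k)" for k
        by (cases "k = k0") (auto intro!: continuous_intros)
      have "continuous_on UNIV W"
        unfolding W_def by (intro continuous_on_vec_lambda continuous_on_diff c)
      then have "continuous_on UNIV (\<lambda>s. N (W s))"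
        using linear_continuous_on_compose[OF _ N(1)] by blast
      then have v: "continuous_on UNIV (\<lambda>s. val (c(k0 := s)) k (N (W s)))" for k
        unfolding val_def by (intro continuous_on_add continuous_on_inner continuous_on_const c)
      show ?thesis
        unfolding Ball_def
        by (intro closed_Collect_all closed_Collect_conj closed_Collect_imp closed_Collect_le
            closed_Collect_const open_Collect_const v)
    qed
    finally show ?thesis .
  qed
  then have "closed (\<Union>(P, Q)\<in>G \<times> G. X (snd \<circ> P) (snd \<circ> Q))"
    using finG by (intro closed_UN) auto
  also have "(\<Union>(P, Q)\<in>G \<times> G. X (snd \<circ> P) (snd \<circ> Q)) = {s. \<exists>p q y. crossing I (c(k0 := s)) p q y}"
  proof (intro equalityI subsetI)
    fix s assume "s \<in> {s. \<exists>p q y. crossing I (c(k0 := s)) p q y}"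
    then obtain p q y where cr: "crossing I (c(k0 := s)) p q y" by blast
    then have "(\<lambda>i. (i, p i)) \<in> G" "(\<lambda>i. (i, q i)) \<in> G"
      by (auto simp: G_def crossing_def active_def)
    moreover have "s \<in> X (snd \<circ> (\<lambda>i. (i, p i))) (snd \<circ> (\<lambda>i. (i, q i)))"
      using cr by (auto simp: X_def o_def)
    ultimately show "s \<in> (\<Union>(P, Q)\<in>G \<times> G. X (snd \<circ> P) (snd \<circ> Q))" by blast
  qed (auto simp: X_def)
  finally show ?thesis .
qed

lemma card_pairs:
  fixes p q :: "'n::finite \<Rightarrow> 'n monomial"
  assumes "\<And>i. p i \<noteq> q i"
  shows "card (range (\<lambda>i. (i, p i)) \<union> range (\<lambda>i. (i, q i))) = 2 * CARD('n)"
proof -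
  have "card (range (\<lambda>i. (i, r i))) = CARD('n)" for r :: "'n \<Rightarrow> 'n monomial"
    by (rule card_image) (auto simp: inj_on_def)
  moreover have "range (\<lambda>i. (i, p i)) \<inter> range (\<lambda>i. (i, q i)) = {}" using assms by auto
  ultimately show ?thesis by (subst card_Un_disjoint) auto
qed

lemma transversal_distinct:
  assumes "transversal (\<lambda>i. exponent_diff (p i) (q i))"
  shows "p i \<noteq> q i"
proof
  assume "p i = q i"
  moreover obtain N where "linear N" "\<And>w i. exponent_diff (p i) (q i) \<bullet> N w = w $ i"
    using transversal_solve[OF assms] by blast
  then have "exponent_diff (p i) (q i) \<bullet> N (axis i 1) = 1" by (simp add: axis_def)
  ultimately show False by (simp add: exponent_diff_expo)
qed

text \<open>
  Only \<open>c\<close> on \<open>I\<close> is generic, and the new coefficient \<open>s\<close> is arbitrary. At a crossing the active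
  monomials other than \<open>k0\<close> are tied, so that there are at most \<open>2n\<close> of them. With \<open>k0\<close> this
  leaves at most one active monomial outside the \<open>2n\<close> chosen ones, which is what
  \<open>crossing_persists\<close> requires. Hence the set of good \<open>s\<close> is open and closed.
\<close>

lemma crossing_add_monomial:
  fixes I :: "('n::finite \<times> 'n monomial) set"
  assumes fin: "finite I" and gen: "generic I c" and new: "k0 \<notin> I"
    and cr: "crossing I c p q y"
  shows "\<exists>p q y. crossing (insert k0 I) (c(k0 := s)) p q y"
proof -
  let ?I = "insert k0 I"
  define X where "X = {s. \<exists>p q y. crossing ?I (c(k0 := s)) p q y}"
  have "closed X" unfolding X_def using fin by (intro closed_crossing) simp
  moreover have "open X"
    unfolding open_contains_ball
  proof
    fix s assume "s \<in> X"
    then obtain p q y where cr: "crossing ?I (c(k0 := s)) p q y" unfolding X_def by blast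
    let ?A = "active ?I (c(k0 := s)) y" and ?P = "range (\<lambda>i. (i, p i)) \<union> range (\<lambda>i. (i, q i))"
    have finA: "finite ?A" using fin by (auto simp: active_def)
    have PA: "?P \<subseteq> ?A" using cr by (auto simp: crossing_def)
    have "val c k y = val (c(k0 := s)) (fst k, p (fst k)) y" if "k \<in> ?A - {k0}" for k
    proof -
      have "val c k y = val (c(k0 := s)) k y" using that by (simp add: val_def)
      also have "\<dots> = val (c(k0 := s)) (fst k, p (fst k)) y"
        using that cr unfolding crossing_def active_def by (auto intro!: antisym)
      finally show ?thesis .
    qed
    then have "independent (cayley ` (?A - {k0}))"
      by (intro generic_tied[OF gen, where \<mu> = "\<lambda>i. val (c(k0 := s)) (i, p i) y"])
        (auto simp: active_def)
    then have "card (?A - {k0}) \<le> DIM((real ^ 'n) \<times> (real ^ 'n))"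
      using independent_bound[of "cayley ` (?A - {k0})"] card_cayley by metis
    moreover have "card ?A \<le> card (?A - {k0}) + 1"
      using finA by (cases "k0 \<in> ?A") (auto simp: card_Diff_singleton)
    ultimately have few: "card ?A \<le> 2 * CARD('n) + 1" by simp
    have "card ?P = 2 * CARD('n)"
      using cr by (intro card_pairs transversal_distinct) (simp add: crossing_def)
    then have extra: "card (?A - ?P) \<le> 1"
      using few PA finA by (subst card_Diff_subset) (auto intro: finite_subset)
    obtain j where j: "\<And>k. k \<in> ?A - ?P \<Longrightarrow> fst k = j"
    proof (cases "?A - ?P = {}")
      case False
      then obtain k where k: "k \<in> ?A - ?P" by blast
      have "finite (?A - ?P)" "card (?A - ?P) \<le> Suc 0" using finA extra by simp_all
      then have "\<forall>l\<in>?A - ?P. l = k" using card_le_Suc0_iff_eq k by blast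
      then show ?thesis using that[of "fst k"] by metis
    qed (use that in auto)
    have "k = (i, p i) \<or> k = (i, q i)" if "i \<noteq> j" "k \<in> ?A" "fst k = i" for i k
    proof -
      have "k \<in> ?P" using j[of k] that by blast
      then show ?thesis using that(3) by auto
    qed
    then obtain \<eta> where \<eta>: "\<eta> > 0"
      "\<And>c'. (\<And>k. k \<in> ?I \<Longrightarrow> \<bar>c' k - (c(k0 := s)) k\<bar> \<le> \<eta>) \<Longrightarrow> \<exists>p' q' y'. crossing ?I c' p' q' y'"
      using crossing_persists[OF _ cr, of j] fin by (metis finite_insert)
    have "ball s \<eta> \<subseteq> X"
    proof
      fix s' assume "s' \<in> ball s \<eta>"
      then have "\<bar>s' - s\<bar> \<le> \<eta>" by (simp add: dist_real_def)
      then show "s' \<in> X" unfolding X_def mem_Collect_eq using \<eta>(1) by (intro \<eta>(2)) auto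
    qed
    then show "\<exists>e>0. ball s e \<subseteq> X" using \<eta>(1) by blast
  qed
  moreover have "X \<noteq> {}"
  proof -
    \<comment> \<open>For this coefficient the new monomial just reaches the minimum at the old crossing.\<close>
    define s where "s = val c (fst k0, p (fst k0)) y - expo (snd k0) \<bullet> y"
    have old: "val (c(k0 := s)) k y = val c k y" if "k \<in> I" for k
      using that new by (auto simp: val_def)
    have k0: "val (c(k0 := s)) k0 y = val c (fst k0, p (fst k0)) y"
      by (simp add: val_def s_def)
    have act: "k \<in> active ?I (c(k0 := s)) y" if "k \<in> active I c y" for k
    proof -
      have "val c k y \<le> val c (fst k, p (fst k)) y"
        using that cr unfolding crossing_def active_def by auto
      then show ?thesis using that old k0 by (auto simp: active_def)
    qed
    then have "crossing ?I (c(k0 := s)) p q y" using cr by (auto simp: crossing_def)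
    then show ?thesis by (auto simp: X_def)
  qed
  ultimately have "X = UNIV" using clopen[of X] by blast
  then have "s \<in> X" by simp
  then show ?thesis unfolding X_def by blast
qed

lemma crossing_two_monomials:
  fixes p q :: "'n::finite \<Rightarrow> 'n monomial"
  assumes "transversal (\<lambda>i. exponent_diff (p i) (q i))"
  shows "\<exists>y. crossing (range (\<lambda>i. (i, p i)) \<union> range (\<lambda>i. (i, q i))) c p q y"
proof -
  obtain N where "linear N" and N: "\<And>w i. exponent_diff (p i) (q i) \<bullet> N w = w $ i"
    using transversal_solve[OF assms] by blast
  define y where "y = N (\<chi> i. c (i, p i) - c (i, q i))"
  have "val c (i, p i) y = val c (i, q i) y" for i
    using N[of i "\<chi> i. c (i, p i) - c (i, q i)"]
    by (simp add: val_def y_def exponent_diff_expo inner_diff_left)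
  then show ?thesis using assms by (intro exI[of _ y]) (auto simp: crossing_def active_def)
qed

lemma generic_crossing:
  fixes I :: "('n::finite \<times> 'n monomial) set"
  assumes fin: "finite I" and gen: "generic I c"
    and pq: "transversal (\<lambda>i. exponent_diff (p i) (q i))" "\<And>i. (i, p i) \<in> I" "\<And>i. (i, q i) \<in> I"
  shows "\<exists>p q y. crossing I c p q y"
proof -
  let ?P = "range (\<lambda>i. (i, p i)) \<union> range (\<lambda>i. (i, q i))"
  have "J \<subseteq> I \<Longrightarrow> \<exists>p q y. crossing (?P \<union> J) c p q y" if "finite J" for J
    using that
  proof (induction J rule: finite_induct)
    case empty
    then show ?case using crossing_two_monomials[OF pq(1), of c] unfolding Un_empty_right by blast
  next
    case (insert k J)
    show ?case
    proof (cases "k \<in> ?P \<union> J")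
      case True
      then show ?thesis using insert by (simp add: insert_absorb)
    next
      case False
      have "?P \<union> J \<subseteq> I" using pq insert.prems by auto
      then have "generic (?P \<union> J) c" "finite (?P \<union> J)"
        using generic_subset[OF gen] finite_subset[OF _ fin] by simp_all
      then show ?thesis
        using crossing_add_monomial[of "?P \<union> J" c k _ _ _ "c k"] False insert by auto
    qed
  qed
  from this[OF fin] have "\<exists>p q y. crossing (?P \<union> I) c p q y" by simp
  moreover have "?P \<union> I = I" using pq by auto
  ultimately show ?thesis by simp
qed

section \<open>The neighbourhood of a point\<close>

lemma active_exists:
  assumes "finite J" "k \<in> J"
  obtains l where "l \<in> active J c y" "fst l = fst k"
proof -
  let ?R = "{l \<in> J. fst l = fst k}"
  have "k \<in> ?R" using assms by simp
  then have "finite ?R" "?R \<noteq> {}" using assms(1) by (simp, blast)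
  then obtain l where l: "is_arg_min (\<lambda>l. val c l y) (\<lambda>l. l \<in> ?R) l"
    using ex_is_arg_min_if_finite by blast
  then have "l \<in> active J c y"
    unfolding is_arg_min_linorder active_def by auto
  moreover have "fst l = fst k" using l unfolding is_arg_min_linorder by simp
  ultimately show thesis by (rule that)
qed

text \<open>
  By finiteness the monomials that are not minimal at \<open>x\<close> exceed the minimum of their row by a
  fixed gap, which small changes of the coefficients and of the point cannot close.
\<close>

lemma active_near:
  fixes J :: "('n::finite \<times> 'n monomial) set"
  assumes fin: "finite J"
  obtains \<rho> where "\<rho> > 0"
    "\<And>c y. (\<And>k. k \<in> J \<Longrightarrow> \<bar>c k - a k\<bar> \<le> \<rho>) \<Longrightarrow> dist x y \<le> \<rho> \<Longrightarrow>
      active J c y = active (active J a x) c y"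
proof -
  let ?I = "active J a x"
  define D where "D = {(k, l). k \<in> J - ?I \<and> l \<in> ?I \<and> fst l = fst k}"
  have IJ: "?I \<subseteq> J" by (auto simp: active_def)
  have "D \<subseteq> J \<times> J" using IJ by (auto simp: D_def)
  then have finD: "finite D" using fin by (meson finite_SigmaI finite_subset)
  have pos: "val a (fst d) x - val a (snd d) x > 0" if d: "d \<in> D" for d
  proof -
    obtain k l where kl: "d = (k, l)" "k \<in> J" "k \<notin> ?I" "l \<in> ?I" "fst l = fst k"
      using d by (auto simp: D_def)
    then obtain m where "m \<in> J" "fst m = fst k" "val a m x < val a k x"
      unfolding active_def by fastforce
    then show ?thesis using kl unfolding active_def by auto
  qed
  obtain g where g: "g > 0" "g \<le> 1" "\<And>d. d \<in> D \<Longrightarrow> g \<le> val a (fst d) x - val a (snd d) x"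
    using finite_uniform_gap[OF finD, of "\<lambda>d. val a (fst d) x - val a (snd d) x", OF pos] by blast
  obtain E where E: "E \<ge> 0" "\<And>k. k \<in> J \<Longrightarrow> norm (expo (snd k)) \<le> E"
    using finite_uniform_bound[OF fin, of "\<lambda>k. norm (expo (snd k))"] by auto
  define \<rho> where "\<rho> = (g / 4) / (1 + E)"
  have "1 + E \<noteq> 0" using E(1) by simp
  from iffD1[OF nonzero_eq_divide_eq[OF this] \<rho>_def] have "\<rho> * (1 + E) = g / 4" .
  then have \<rho>: "\<rho> > 0" "\<rho> + E * \<rho> = g / 4"
    using g(1) E(1) by (simp add: \<rho>_def, simp add: algebra_simps)
  show ?thesis
  proof (rule that[OF \<rho>(1)])
    fix c y assume c: "\<And>k. k \<in> J \<Longrightarrow> \<bar>c k - a k\<bar> \<le> \<rho>" and y: "dist x y \<le> \<rho>"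
    have close: "\<bar>val c k y - val a k x\<bar> \<le> g / 4" if "k \<in> J" for k
    proof -
      have "\<bar>expo (snd k) \<bullet> (y - x)\<bar> \<le> norm (expo (snd k)) * norm (y - x)"
        by (rule Cauchy_Schwarz_ineq2)
      also have "\<dots> \<le> E * \<rho>"
        using E(1) E(2)[OF that] y by (intro mult_mono) (auto simp: dist_norm norm_minus_commute)
      finally have "\<bar>expo (snd k) \<bullet> (y - x)\<bar> \<le> E * \<rho>" .
      moreover have "val c k y - val a k x = (c k - a k) + expo (snd k) \<bullet> (y - x)"
        by (simp add: val_def inner_diff_right)
      ultimately show ?thesis using c[OF that] \<rho>(2) by linarith
    qed
    have gap: "val c l y < val c k y" if "k \<in> J - ?I" "l \<in> ?I" "fst l = fst k" for k l
    proof -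
      have "k \<in> J" "l \<in> J" using that IJ by auto
      moreover have "g \<le> val a k x - val a l x" using g(3)[of "(k, l)"] that by (simp add: D_def)
      ultimately show ?thesis using close[of k] close[of l] g(1) by linarith
    qed
    show "active J c y = active ?I c y"
    proof (intro equalityI subsetI)
      fix k assume k: "k \<in> active J c y"
      then have kJ: "k \<in> J" by (simp add: active_def)
      obtain l where l: "l \<in> ?I" "fst l = fst k" using active_exists[OF fin kJ] by blast
      have "k \<in> ?I"
      proof (rule ccontr)
        assume "k \<notin> ?I"
        then have "val c l y < val c k y" using gap kJ l by blast
        moreover have "val c k y \<le> val c l y" using k l IJ by (auto simp: active_def)
        ultimately show False by simp
      qed
      then show "k \<in> active ?I c y" using k IJ unfolding active_def by blast
    next
      fix k assume k: "k \<in> active ?I c y"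
      then have kI: "k \<in> ?I" by (simp add: active_def)
      have "val c k y \<le> val c l y" if "l \<in> J" "fst l = fst k" for l
      proof (cases "l \<in> ?I")
        case True
        then show ?thesis using k that unfolding active_def[of ?I] by blast
      next
        case False
        then show ?thesis using gap[of l k] kI that by simp
      qed
      then show "k \<in> active J c y" using kI IJ unfolding active_def[of J c y] by blast
    qed
  qed
qed

lemma transversal_bound:
  fixes v :: "'n::finite \<Rightarrow> real ^ 'n"
  assumes "transversal v"
  shows "\<exists>K\<ge>0. \<forall>z \<beta>. (\<forall>i. \<bar>v i \<bullet> z\<bar> \<le> \<beta>) \<longrightarrow> norm z \<le> K * \<beta>"
proof -
  obtain N where N: "linear N" "\<And>w i. v i \<bullet> N w = w $ i"
    using transversal_solve[OF assms] by blast
  obtain K where K: "K > 0" "\<And>w. norm (N w) \<le> K * norm w"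
    using linear_bounded_pos[OF N(1)] by blast
  have "norm z \<le> (K * CARD('n)) * \<beta>" if z: "\<forall>i. \<bar>v i \<bullet> z\<bar> \<le> \<beta>" for z \<beta>
  proof -
    define w where "w = (\<chi> i. v i \<bullet> z)"
    have "v i \<bullet> (z - N w) = 0" for i by (simp add: inner_diff_right N(2) w_def)
    then have "z = N w" using assms unfolding transversal_def by (metis eq_iff_diff_eq_0)
    then have "norm z \<le> K * norm w" using K(2) by simp
    also have "norm w \<le> CARD('n) * \<beta>"
      using norm_le_l1_cart[of w] sum_bounded_above[of UNIV "\<lambda>i. \<bar>w $ i\<bar>" \<beta>] z
      by (force simp: w_def)
    finally show ?thesis using K(1) by (simp add: mult.assoc)
  qed
  then show ?thesis using K(1) by (intro exI[of _ "K * CARD('n)"]) auto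
qed

text \<open>
  The difference \<open>y - x\<close> solves a linear system whose matrix is one of finitely many and whose right
  hand side consists of differences of coefficient changes.
\<close>

lemma crossing_bound:
  fixes I :: "('n::finite \<times> 'n monomial) set"
  assumes fin: "finite I"
    and tied: "\<And>k l. k \<in> I \<Longrightarrow> l \<in> I \<Longrightarrow> fst k = fst l \<Longrightarrow> val a k x = val a l x"
  obtains K where "K \<ge> 0"
    "\<And>c p q y \<epsilon>. crossing I c p q y \<Longrightarrow> (\<And>k. k \<in> I \<Longrightarrow> \<bar>c k - a k\<bar> \<le> \<epsilon>) \<Longrightarrow> dist x y \<le> K * \<epsilon>"
proof -
  define F where "F = {(P, Q). P \<in> UNIV \<rightarrow>\<^sub>E I \<and> Q \<in> UNIV \<rightarrow>\<^sub>E I \<and>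
    transversal (\<lambda>i::'n. exponent_diff (snd (P i)) (snd (Q i)))}"
  have "F \<subseteq> (UNIV \<rightarrow>\<^sub>E I) \<times> (UNIV \<rightarrow>\<^sub>E I)" by (auto simp: F_def)
  moreover have "finite ((UNIV :: 'n set) \<rightarrow>\<^sub>E I)" by (rule finite_PiE) (use fin in auto)
  ultimately have finF: "finite F" by (meson finite_SigmaI finite_subset)
  have "\<forall>f\<in>F. \<exists>K\<ge>0. \<forall>z \<beta>. (\<forall>i. \<bar>exponent_diff (snd (fst f i)) (snd (snd f i)) \<bullet> z\<bar> \<le> \<beta>)
      \<longrightarrow> norm z \<le> K * \<beta>"
    using transversal_bound by (auto simp: F_def)
  from bchoice[OF this] obtain L where L: "\<And>f. f \<in> F \<Longrightarrow> L f \<ge> 0"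
    "\<And>f z \<beta>. f \<in> F \<Longrightarrow> (\<forall>i. \<bar>exponent_diff (snd (fst f i)) (snd (snd f i)) \<bullet> z\<bar> \<le> \<beta>)
      \<Longrightarrow> norm z \<le> L f * \<beta>"
    by blast
  obtain K where K: "K \<ge> 0" "\<And>f. f \<in> F \<Longrightarrow> \<bar>L f\<bar> \<le> K"
    using finite_uniform_bound[OF finF] by blast
  show ?thesis
  proof (rule that[of "2 * K"])
    show "2 * K \<ge> 0" using K by simp
    fix c p q y \<epsilon>
    assume cr: "crossing I c p q y" and c: "\<And>k. k \<in> I \<Longrightarrow> \<bar>c k - a k\<bar> \<le> \<epsilon>"
    have I: "(i, p i) \<in> I" "(i, q i) \<in> I" for i
      using cr by (auto simp: crossing_def active_def)
    let ?f = "(\<lambda>i. (i, p i), \<lambda>i. (i, q i))"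
    have F: "?f \<in> F" using cr I by (auto simp: F_def crossing_def)
    have "\<bar>exponent_diff (p i) (q i) \<bullet> (y - x)\<bar> \<le> 2 * \<epsilon>" for i
    proof -
      have "val c (i, p i) y = val c (i, q i) y"
        using cr unfolding crossing_def active_def by (auto intro!: antisym)
      moreover have "val a (i, p i) x = val a (i, q i) x" using tied I by simp
      ultimately have "exponent_diff (p i) (q i) \<bullet> (y - x) =
          (c (i, p i) - a (i, p i)) - (c (i, q i) - a (i, q i))"
        by (simp add: val_def exponent_diff_expo inner_diff_left inner_diff_right)
      then show ?thesis using c[OF I(1)[of i]] c[OF I(2)[of i]] by linarith
    qed
    then have "norm (y - x) \<le> L ?f * (2 * \<epsilon>)" using L(2)[OF F] by simp
    also have "\<dots> \<le> K * (2 * \<epsilon>)"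
    proof (rule mult_right_mono)
      show "L ?f \<le> K" using K(2)[OF F] by simp
      show "0 \<le> 2 * \<epsilon>" using c[OF I(1)[of undefined]] by linarith
    qed
    finally show "dist x y \<le> 2 * K * \<epsilon>" by (simp add: dist_norm norm_minus_commute)
  qed
qed

section \<open>Stable solutions of tropical systems\<close>

lemma starred_iff_active:
  assumes "is_trop_poly (A i)"
  shows "starred A x i m \<longleftrightarrow> (i, m) \<in> active (coeff_index A) (coeff_vec A) x"
proof -
  have fin: "finite (dom (A i))" using assms by (simp add: is_trop_poly_def)
  have "monomial_value (A i) m x = trop_eval (A i) x \<longleftrightarrow>
      (\<forall>m'\<in>dom (A i). monomial_value (A i) m x \<le> monomial_value (A i) m' x)" if "m \<in> dom (A i)"
  proof
    assume "monomial_value (A i) m x = trop_eval (A i) x"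
    then show "\<forall>m'\<in>dom (A i). monomial_value (A i) m x \<le> monomial_value (A i) m' x"
      using fin by (simp add: trop_eval_def)
  next
    assume "\<forall>m'\<in>dom (A i). monomial_value (A i) m x \<le> monomial_value (A i) m' x"
    then show "monomial_value (A i) m x = trop_eval (A i) x"
      unfolding trop_eval_def using fin that by (intro Min_eqI[symmetric]) auto
  qed
  then show ?thesis
    by (auto simp: starred_def active_def coeff_index_def monomial_value_val)
qed

lemma solution_iff_active:
  assumes "\<forall>i. is_trop_poly (A i)"
  shows "solution A y \<longleftrightarrow> (\<forall>i. \<exists>m m'. m \<noteq> m' \<and>
    (i, m) \<in> active (coeff_index A) (coeff_vec A) y \<and> (i, m') \<in> active (coeff_index A) (coeff_vec A) y)"
proof -
  have "trop_zero (A i) y \<longleftrightarrow> (\<exists>m m'. m \<noteq> m' \<and> starred A y i m \<and> starred A y i m')" for i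
    by (auto simp: trop_zero_def starred_def)
  then show ?thesis using assms by (simp add: solution_def starred_iff_active)
qed

lemma finite_coeff_index:
  assumes "\<forall>i. is_trop_poly (A i)"
  shows "finite (coeff_index A)"
  using assms by (auto simp: coeff_index_def is_trop_poly_def)

lemma amplitude_le_iff:
  assumes "\<forall>i. is_trop_poly (A i)"
  shows "amplitude A B \<le> \<epsilon> \<longleftrightarrow> (\<forall>k\<in>coeff_index A. \<bar>coeff_vec B k - coeff_vec A k\<bar> \<le> \<epsilon>)"
proof -
  have "dom (A undefined) \<noteq> {}" using assms by (simp add: is_trop_poly_def)
  then have "coeff_index A \<noteq> {}" by (auto simp: coeff_index_def)
  then show ?thesis using finite_coeff_index[OF assms] by (simp add: amplitude_def)
qed

lemma perturbation_same_monomials: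
  assumes "\<forall>i. is_trop_poly (A i)" "perturbation A B"
  shows "coeff_index B = coeff_index A" "\<forall>i. is_trop_poly (B i)"
  using assms by (auto simp: perturbation_def coeff_index_def is_trop_poly_def)

text \<open>
  By their number the vectors span the whole space. If \<open>u\<close> is orthogonal to all differences, then
  \<open>u\<close> can be completed by the values \<open>- (expo (p i) \<bullet> u)\<close> to a vector orthogonal to all of them.
\<close>

lemma transversal_if_cayley_independent:
  fixes p q :: "'n::finite \<Rightarrow> 'n monomial"
  assumes ne: "\<And>i. p i \<noteq> q i"
    and ind: "independent (cayley ` (range (\<lambda>i. (i, p i)) \<union> range (\<lambda>i. (i, q i))))" (is "independent ?L")
  shows "transversal (\<lambda>i. exponent_diff (p i) (q i))"
  unfolding transversal_def
proof (intro allI impI)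
  fix u assume u: "\<forall>i. exponent_diff (p i) (q i) \<bullet> u = 0"
  have "UNIV \<subseteq> span ?L"
    using ind ne by (intro card_ge_dim_independent) (auto simp: card_cayley card_pairs dim_UNIV)
  define z where "z = ((\<chi> i. - (expo (p i) \<bullet> u)), u)"
  have "z \<bullet> w = 0" if "w \<in> ?L" for w
    using that u by (auto simp: z_def cayley_def inner_axis exponent_diff_expo inner_diff_left
        inner_commute[of u])
  then have "orthogonal z w" if "w \<in> span ?L" for w
    by (intro orthogonal_to_span[OF that]) (simp add: orthogonal_def)
  then have "orthogonal z z" using \<open>UNIV \<subseteq> span ?L\<close> by blast
  then have "z = 0" by (simp add: orthogonal_self)
  then show "u = 0" by (simp add: z_def prod_eq_iff)
qed

lemma affine_hyperplane_cong:
  assumes "affine_hyperplane J H" "\<And>k. k \<in> J \<Longrightarrow> c k = c' k"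
  shows "c \<in> H \<longleftrightarrow> c' \<in> H"
proof -
  obtain \<alpha> \<beta> where H: "H = {c. (\<Sum>k\<in>J. \<alpha> k * c k) = \<beta>}"
    using assms(1) by (auto simp: affine_hyperplane_def)
  have "(\<Sum>k\<in>J. \<alpha> k * c k) = (\<Sum>k\<in>J. \<alpha> k * c' k)" using assms(2) by (intro sum.cong) auto
  then show ?thesis by (simp add: H)
qed

text \<open>
  The hyperplanes from the definition of stability are joined with those of
  \<open>generic_outside_hyperplanes\<close>; some small perturbation avoids all of them.
\<close>

lemma stable_imp_transversal:
  fixes A :: "'n::finite trop_system"
  assumes A: "\<forall>i. is_trop_poly (A i)" and st: "stable_point A x"
  obtains p q where "\<And>i. starred A x i (p i)" "\<And>i. starred A x i (q i)"
    "transversal (\<lambda>i. exponent_diff (p i) (q i))"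
proof -
  let ?J = "coeff_index A" and ?a = "coeff_vec A"
  have fin: "finite ?J" by (rule finite_coeff_index[OF A])
  from st obtain \<H> where "finite \<H> \<and> (\<forall>H\<in>\<H>. affine_hyperplane ?J H) \<and>
       (\<exists>\<Delta>>0. \<forall>\<delta>. 0 < \<delta> \<and> \<delta> < \<Delta> \<longrightarrow>
         (\<exists>\<epsilon>>0. \<forall>B. perturbation A B \<and> coeff_vec B \<notin> \<Union>\<H> \<and> amplitude A B \<le> \<epsilon> \<longrightarrow>
           (\<exists>y\<in>ball x \<delta>. solution B y)))"
    unfolding stable_point_def by (rule exE)
  then obtain \<Delta> where \<H>: "finite \<H>" "\<And>H. H \<in> \<H> \<Longrightarrow> affine_hyperplane ?J H" and \<Delta>: "\<Delta> > 0"
    and stab: "\<forall>\<delta>. 0 < \<delta> \<and> \<delta> < \<Delta> \<longrightarrow> (\<exists>\<epsilon>>0. \<forall>B. perturbation A B \<and> coeff_vec B \<notin> \<Union>\<H> \<and>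
      amplitude A B \<le> \<epsilon> \<longrightarrow> (\<exists>y\<in>ball x \<delta>. solution B y))"
    by (elim conjE exE) (rule that, simp_all)
  obtain \<G> where \<G>: "finite \<G>" "\<And>H. H \<in> \<G> \<Longrightarrow> affine_hyperplane ?J H"
    "\<And>c. c \<notin> \<Union>\<G> \<Longrightarrow> generic ?J c"
    using generic_outside_hyperplanes[OF fin order_refl] by blast
  obtain \<rho> where \<rho>: "\<rho> > 0" and near: "\<And>c y. (\<And>k. k \<in> ?J \<Longrightarrow> \<bar>c k - ?a k\<bar> \<le> \<rho>) \<Longrightarrow> dist x y \<le> \<rho> \<Longrightarrow>
      active ?J c y = active (active ?J ?a x) c y"
    using active_near[OF fin] by blast
  define \<delta> where "\<delta> = min (\<Delta> / 2) \<rho>"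
  have \<delta>: "0 < \<delta>" "\<delta> < \<Delta>" "\<delta> \<le> \<rho>" using \<Delta> \<rho> by (auto simp: \<delta>_def)
  obtain \<epsilon> where \<epsilon>: "\<epsilon> > 0" "\<And>B. perturbation A B \<Longrightarrow> coeff_vec B \<notin> \<Union>\<H> \<Longrightarrow> amplitude A B \<le> \<epsilon>
      \<Longrightarrow> \<exists>y\<in>ball x \<delta>. solution B y"
    using spec[OF stab, of \<delta>] \<delta>(1,2) by auto
  have "\<exists>c. c \<notin> \<Union>(\<H> \<union> \<G>) \<and> (\<forall>k\<in>?J. \<bar>c k - ?a k\<bar> \<le> min \<epsilon> \<rho>)"
    by (rule avoid_hyperplanes[OF fin]) (use \<H> \<G> \<epsilon> \<rho> in auto)
  then obtain c where c': "c \<notin> \<Union>(\<H> \<union> \<G>) \<and> (\<forall>k\<in>?J. \<bar>c k - ?a k\<bar> \<le> min \<epsilon> \<rho>)"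
    by (rule exE)
  note c = conjunct1[OF c'] bspec[OF conjunct2[OF c']]
  define B :: "'n trop_system" where "B i m = (if m \<in> dom (A i) then Some (c (i, m)) else None)" for i m
  have B: "perturbation A B" by (auto simp: perturbation_def B_def dom_def)
  note same = perturbation_same_monomials[OF A B]
  let ?b = "coeff_vec B"
  have bc: "?b k = c k" if "k \<in> ?J" for k
    using that by (auto simp: coeff_vec_def coeff_index_def B_def split: if_splits)
  have "?b \<notin> H" if "H \<in> \<H> \<union> \<G>" for H
  proof -
    have "affine_hyperplane ?J H" using that \<H>(2) \<G>(2) by blast
    from affine_hyperplane_cong[OF this, of ?b c] bc have "?b \<in> H \<longleftrightarrow> c \<in> H" by blast
    then show ?thesis using c(1) that by blast
  qed
  then have out: "?b \<notin> \<Union>\<H>" "?b \<notin> \<Union>\<G>" by blast+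
  have close: "\<bar>?b k - ?a k\<bar> \<le> min \<epsilon> \<rho>" if "k \<in> ?J" for k using c(2) bc that by simp
  then have "amplitude A B \<le> \<epsilon>" by (simp add: amplitude_le_iff[OF A])
  then obtain y where y: "dist x y \<le> \<rho>" "solution B y"
    using \<epsilon>(2)[OF B out(1)] \<delta>(3) by force
  have "\<forall>i. \<exists>m m'. m \<noteq> m' \<and> (i, m) \<in> active ?J ?b y \<and> (i, m') \<in> active ?J ?b y"
    using y(2) unfolding solution_iff_active[OF same(2)] same(1) .
  then obtain p q where pq: "\<And>i. p i \<noteq> q i" "\<And>i. (i, p i) \<in> active ?J ?b y" "\<And>i. (i, q i) \<in> active ?J ?b y"
    by metis
  let ?P = "range (\<lambda>i. (i, p i)) \<union> range (\<lambda>i. (i, q i))"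
  have "active ?J ?b y = active (active ?J ?a x) ?b y"
    using near y(1) close by simp
  then have active_x: "?P \<subseteq> active ?J ?a x" using pq by (auto simp: active_def)
  have "independent (cayley ` ?P)"
  proof (rule generic_tied[OF \<G>(3)[OF out(2)], where \<mu> = "\<lambda>i. val ?b (i, p i) y"])
    show "?P \<subseteq> ?J" using pq by (auto simp: active_def)
    show "val ?b k y = val ?b (fst k, p (fst k)) y" if k: "k \<in> ?P" for k
    proof -
      have "k \<in> active ?J ?b y" "(fst k, p (fst k)) \<in> active ?J ?b y" using k pq by auto
      then show ?thesis by (auto simp: active_def intro!: antisym)
    qed
  qed
  then have "transversal (\<lambda>i. exponent_diff (p i) (q i))"
    by (intro transversal_if_cayley_independent pq(1))
  moreover have "starred A x i (p i)" "starred A x i (q i)" for i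
    using active_x A by (auto simp: starred_iff_active)
  ultimately show thesis using that by blast
qed

text \<open>
  Genericity is required only for the monomials starred at \<open>x\<close>. It does not depend on \<open>\<delta>\<close>, and
  neither does the constant \<open>K\<close>, so \<open>\<epsilon>\<close> can be taken proportional to \<open>\<delta>\<close>, up to the size \<open>\<rho>\<close> of the
  neighbourhood in which no other monomials matter.
\<close>

lemma transversal_imp_stable:
  fixes A :: "'n::finite trop_system"
  assumes A: "\<forall>i. is_trop_poly (A i)"
    and star: "\<And>i. starred A x i (p i)" "\<And>i. starred A x i (q i)"
    and tr: "transversal (\<lambda>i. exponent_diff (p i) (q i))"
  shows "stable_point A x"
proof -
  let ?J = "coeff_index A" and ?a = "coeff_vec A"
  let ?I = "active ?J ?a x"
  have fin: "finite ?J" by (rule finite_coeff_index[OF A])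
  have IJ: "?I \<subseteq> ?J" by (auto simp: active_def)
  have finI: "finite ?I" using fin IJ finite_subset by blast
  obtain \<G> where \<G>: "finite \<G>" "\<And>H. H \<in> \<G> \<Longrightarrow> affine_hyperplane ?J H"
    "\<And>c. c \<notin> \<Union>\<G> \<Longrightarrow> generic ?I c"
    using generic_outside_hyperplanes[OF fin IJ] by blast
  obtain \<rho> where \<rho>: "\<rho> > 0" and near: "\<And>c y. (\<And>k. k \<in> ?J \<Longrightarrow> \<bar>c k - ?a k\<bar> \<le> \<rho>) \<Longrightarrow> dist x y \<le> \<rho> \<Longrightarrow>
      active ?J c y = active ?I c y"
    using active_near[OF fin] by blast
  have tied: "val ?a k x = val ?a l x" if "k \<in> ?I" "l \<in> ?I" "fst k = fst l" for k l
    using that by (auto simp: active_def intro!: antisym)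
  obtain K where K: "K \<ge> 0" "\<And>c p q y \<epsilon>. crossing ?I c p q y \<Longrightarrow> (\<And>k. k \<in> ?I \<Longrightarrow> \<bar>c k - ?a k\<bar> \<le> \<epsilon>)
      \<Longrightarrow> dist x y \<le> K * \<epsilon>"
    using crossing_bound[OF finI tied] by blast
  have "\<exists>\<epsilon>>0. \<forall>B. perturbation A B \<and> coeff_vec B \<notin> \<Union>\<G> \<and> amplitude A B \<le> \<epsilon>
      \<longrightarrow> (\<exists>y\<in>ball x \<delta>. solution B y)" if \<delta>: "0 < \<delta>" for \<delta>
  proof -
    define \<epsilon> where "\<epsilon> = min \<rho> (min \<rho> \<delta> / (2 * (K + 1)))"
    have \<epsilon>: "\<epsilon> > 0" "\<epsilon> \<le> \<rho>" using \<rho> \<delta> K(1) by (auto simp: \<epsilon>_def)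
    have "K * \<epsilon> \<le> K * (min \<rho> \<delta> / (2 * (K + 1)))"
      using K(1) by (intro mult_left_mono) (auto simp: \<epsilon>_def)
    also have "\<dots> < min \<rho> \<delta>"
    proof -
      have "K / (2 * (K + 1)) < 1" using K(1) by simp
      then have "min \<rho> \<delta> * (K / (2 * (K + 1))) < min \<rho> \<delta> * 1"
        using \<rho> \<delta> by (intro mult_strict_left_mono) auto
      then show ?thesis by (simp add: mult.commute)
    qed
    finally have K\<epsilon>: "K * \<epsilon> < min \<rho> \<delta>" .
    have "\<exists>y\<in>ball x \<delta>. solution B y"
      if B: "perturbation A B" "coeff_vec B \<notin> \<Union>\<G>" "amplitude A B \<le> \<epsilon>" for B
    proof -
      let ?b = "coeff_vec B"
      note same = perturbation_same_monomials[OF A B(1)]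
      have close: "\<bar>?b k - ?a k\<bar> \<le> \<epsilon>" if "k \<in> ?J" for k
        using B(3) that by (simp add: amplitude_le_iff[OF A])
      have "(i, p i) \<in> ?I" "(i, q i) \<in> ?I" for i
        using star A by (auto simp: starred_iff_active)
      then obtain p' q' y where cr: "crossing ?I ?b p' q' y"
        using generic_crossing[OF finI \<G>(3)[OF B(2)] tr] by blast
      have "dist x y \<le> K * \<epsilon>" using K(2)[OF cr] close IJ by blast
      then have y: "dist x y < \<delta>" "dist x y \<le> \<rho>" using K\<epsilon> by auto
      have "\<bar>?b k - ?a k\<bar> \<le> \<rho>" if "k \<in> ?J" for k using close[OF that] \<epsilon>(2) by simp
      then have eq: "active ?J ?b y = active ?I ?b y" using near y(2) by blast
      have "p' i \<noteq> q' i" for i using cr transversal_distinct by (auto simp: crossing_def)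
      then have "solution B y"
        unfolding solution_iff_active[OF same(2)] same(1) eq
        using cr unfolding crossing_def by blast
      then show ?thesis using y(1) by auto
    qed
    then show ?thesis using \<epsilon>(1) by blast
  qed
  then show ?thesis
    unfolding stable_point_def using \<G>(1,2)
    by (intro exI[of _ \<G>] conjI exI[of _ 1]) auto
qed

theorem theorem5p10:
  fixes A :: "'n::finite trop_system" and x :: "real ^ 'n"
  assumes "\<forall>i. is_trop_poly (A i)"
    and "\<forall>i. finite_coefficients (A i)"
    and "solution A x"
  shows "stable_point A x \<longleftrightarrow>
    (\<exists>m1 m2 :: 'n \<Rightarrow> 'n monomial.
       (\<forall>i. m1 i \<in> dom (A i) \<and> m2 i \<in> dom (A i) \<and>
            starred A x i (m1 i) \<and> starred A x i (m2 i)) \<and>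
       dim (span (range (\<lambda>i. exponent_diff (m1 i) (m2 i)))) = CARD('n))"
    (is "_ \<longleftrightarrow> ?R")
proof
  assume "stable_point A x"
  then obtain p q where pq: "\<And>i. starred A x i (p i)" "\<And>i. starred A x i (q i)"
    "transversal (\<lambda>i. exponent_diff (p i) (q i))"
    using stable_imp_transversal[OF assms(1)] by blast
  have "dim (span (range (\<lambda>i. exponent_diff (p i) (q i)))) = CARD('n)"
    using pq(3) by (simp only: transversal_iff_dim)
  moreover have "p i \<in> dom (A i)" "q i \<in> dom (A i)" for i
    using pq(1,2) by (auto simp: starred_def)
  ultimately show ?R using pq(1,2) by blast
next
  assume ?R
  then obtain p q where pq: "\<And>i. starred A x i (p i)" "\<And>i. starred A x i (q i)"
    "dim (span (range (\<lambda>i. exponent_diff (p i) (q i)))) = CARD('n)"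
    by blast
  from pq(3) have "transversal (\<lambda>i. exponent_diff (p i) (q i))"
    by (simp only: transversal_iff_dim)
  with pq(1,2) show "stable_point A x"
    by (rule transversal_imp_stable[OF assms(1)])
qed

end
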